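(* Fix an error-bounded lossy compressor configuration $(\tau,m)$ with compression footprint map $\phi_{\tau,m}$ (taking values in $\mathbb{R}^5$), and fix a round $t$. Let $G_H^{(t)}\sim\mathcal{P}_H^{(t)}$ and $G_A^{(t)}\sim\mathcal{P}_A^{(t)}$ be random vectors in $\mathbb{R}^d$ (a random honest update and a random malicious update), defined on a common probability space, and let $$\mu_H^{\phi,t}=\mathbb{E}\big[\phi_{\tau,m}(G_H^{(t)})\big],\qquad \mu_A^{\phi,t}=\mathbb{E}\big[\phi_{\tau,m}(G_A^{(t)})\big],\qquad \Delta_\phi^{(t)}=\big\|\mu_A^{\phi,t}-\mu_H^{\phi,t}\big\|_2 .$$ Suppose there are radii $\mathcal{R}_H^{(t)},\mathcal{R}_A^{(t)}$ and failure probabilities $\gamma_H,\gamma_A\in[0,1)$ such that $$\mathbb{P}\big(\|\phi_{\tau,m}(G_H^{(t)})-\mu_H^{\phi,t}\|_2\le \mathcal{R}_H^{(t)}\big)\ge 1-\gamma_H,$$ $$\mathbb{P}\big(\|\phi_{\tau,m}(G_A^{(t)})-\mu_A^{\phi,t}\|_2\le \mathcal{R}_A^{(t)}\big)\ge 1-\gamma_A .$$ If $$\Delta_\phi^{(t)}>\mathcal{R}_H^{(t)}+\mathcal{R}_A^{(t)},$$ then the dominant honest footprint region $B_H=\{x\in\mathbb{R}^5:\|x-\mu_H^{\phi,t}\|_2\le\mathcal{R}_H^{(t)}\}$ and the dominant malicious footprint region $B_A=\{x\in\mathbb{R}^5:\|x-\mu_A^{\phi,t}\|_2\le\mathcal{R}_A^{(t)}\}$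 are disjoint. Consequently, with probability at least $1-\gamma_H-\gamma_A$, the random honest footprint and the random malicious footprint are separated, i.e. simultaneously $\phi_{\tau,m}(G_H^{(t)})\in B_H$ and $\phi_{\tau,m}(G_A^{(t)})\in B_A$, where $B_H\cap B_A=\emptyset$.
   Context: Let $d\ge 1$. A compressor configuration $(\tau,m)$ consists of a tolerance $\tau$ and an error-bound mode $m$; it determines a compression map $C_{\tau,m}$ on $\mathbb{R}^d$, and $D$ denotes the corresponding decompression map, with $D(C_{\tau,m}(u))\in\mathbb{R}^d$. For $u\in\mathbb{R}^d$ write $\bar u=D(C_{\tau,m}(u))$. The compression footprint of $u$ is the vector $$\phi_{\tau,m}(u)=\big[r_{\tau,m}(u),\,c_{\tau,m}(u),\,q_{\tau,m}(u),\,s_{\tau,m}(u),\,\rho_{\tau,m}(u)\big]^T\in\mathbb{R}^5,$$ with coordinates - relative distortion $r_{\tau,m}(u)=\|u-\bar u\|_2/\|u\|_2$; - cosine similarity $c_{\tau,m}(u)=\langle u,\bar u\rangle/(\|u\|_2\|\bar u\|_2)$; - mean squared error $q_{\tau,m}(u)=\frac1d\|u-\bar u\|_2^2$; - sparsity change $s_{\tau,m}(u)=\frac1d\sum_{j=1}^d\big(\mathbf{1}\{|\bar u_j|\le\kappa\}-\mathbf{1}\{|u_j|\le\kappa\}\big)$, where $\kappa$ is a fixed near-zero threshold; - compression ratio $\rho_{\tau,m}(u)=B_{\mathrm{raw}}(u)/B_{\tau,m}(u)$, where $B_{\mathrm{raw}}(u)$ and $B_{\tau,m}(u)$ are the uncompressed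 and compressed payload sizes of $u$, respectively. $\|\cdot\|_2$ is the Euclidean norm. It is implicit that the footprints $\phi_{\tau,m}(G_H^{(t)})$ and $\phi_{\tau,m}(G_A^{(t)})$ are well-defined random vectors in $\mathbb{R}^5$ whose expectations exist. No assumption is made on the joint distribution of $G_H^{(t)}$ and $G_A^{(t)}$. *)

theory Defs
  imports "HOL-Probability.Probability"
begin

text \<open>
  The ambient space is \<open>real ^ 'd\<close> with \<open>d = CARD('d) \<ge> 1\<close>. The types of error-bound modes
  (\<open>'m\<close>) and of compressed payloads (\<open>'p\<close>) are arbitrary. The compression map takes the tolerance
  and the mode as its first two arguments. \<open>payload_size\<close> measures compressed payloads, so
  \<open>B\<^sub>\<tau>\<^sub>,\<^sub>m(u)\<close> is \<open>payload_size K (compress K \<tau> m u)\<close>. No error-bound property is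
  imposed on the maps.
\<close>

record ('m, 'p, 'd) compressor =
  compress :: "real \<Rightarrow> 'm \<Rightarrow> (real ^ 'd::finite) \<Rightarrow> 'p"
  decompress :: "'p \<Rightarrow> real ^ 'd"
  raw_size :: "(real ^ 'd) \<Rightarrow> nat"
  payload_size :: "'p \<Rightarrow> nat"

definition reconstruct ::
    "('m, 'p, 'd::finite) compressor \<Rightarrow> real \<Rightarrow> 'm \<Rightarrow> (real ^ 'd) \<Rightarrow> real ^ 'd" where
  "reconstruct K \<tau> m u = decompress K (compress K \<tau> m u)"

definition rel_distortion ::
    "('m, 'p, 'd::finite) compressor \<Rightarrow> real \<Rightarrow> 'm \<Rightarrow> (real ^ 'd) \<Rightarrow> real" where
  "rel_distortion K \<tau> m u = norm (u - reconstruct K \<tau> m u) / norm u"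

definition cosine_similarity ::
    "('m, 'p, 'd::finite) compressor \<Rightarrow> real \<Rightarrow> 'm \<Rightarrow> (real ^ 'd) \<Rightarrow> real" where
  "cosine_similarity K \<tau> m u =
     (u \<bullet> reconstruct K \<tau> m u) / (norm u * norm (reconstruct K \<tau> m u))"

definition mean_squared_error ::
    "('m, 'p, 'd::finite) compressor \<Rightarrow> real \<Rightarrow> 'm \<Rightarrow> (real ^ 'd) \<Rightarrow> real" where
  "mean_squared_error K \<tau> m u = 1 / real CARD('d) * (norm (u - reconstruct K \<tau> m u))\<^sup>2"

definition sparsity_change ::
    "real \<Rightarrow> ('m, 'p, 'd::finite) compressor \<Rightarrow> real \<Rightarrow> 'm \<Rightarrow> (real ^ 'd) \<Rightarrow> real" where
  "sparsity_change \<kappa> K \<tau> m u =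
     1 / real CARD('d) *
       (\<Sum>j\<in>UNIV. of_bool (\<bar>reconstruct K \<tau> m u $ j\<bar> \<le> \<kappa>) - of_bool (\<bar>u $ j\<bar> \<le> \<kappa>))"

definition compression_ratio ::
    "('m, 'p, 'd::finite) compressor \<Rightarrow> real \<Rightarrow> 'm \<Rightarrow> (real ^ 'd) \<Rightarrow> real" where
  "compression_ratio K \<tau> m u = real (raw_size K u) / real (payload_size K (compress K \<tau> m u))"

definition footprint ::
    "real \<Rightarrow> ('m, 'p, 'd::finite) compressor \<Rightarrow> real \<Rightarrow> 'm \<Rightarrow> (real ^ 'd) \<Rightarrow> real ^ 5" where
  "footprint \<kappa> K \<tau> m u =
     vector [rel_distortion K \<tau> m u, cosine_similarity K \<tau> m u, mean_squared_error K \<tau> m u,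
             sparsity_change \<kappa> K \<tau> m u, compression_ratio K \<tau> m u]"

text \<open>In the index type \<open>5\<close> the numeral \<open>5\<close> equals \<open>0\<close>, so the last coordinate is reached as
  \<open>$ 5\<close> or \<open>$ 0\<close>.\<close>

lemma footprint_components:
  "footprint \<kappa> K \<tau> m u $ 1 = rel_distortion K \<tau> m u"
  "footprint \<kappa> K \<tau> m u $ 2 = cosine_similarity K \<tau> m u"
  "footprint \<kappa> K \<tau> m u $ 3 = mean_squared_error K \<tau> m u"
  "footprint \<kappa> K \<tau> m u $ 4 = sparsity_change \<kappa> K \<tau> m u"
  "footprint \<kappa> K \<tau> m u $ 5 = compression_ratio K \<tau> m u"
  by (simp_all add: footprint_def vector_def)

text \<open>Division by zero yields \<open>0\<close> in HOL; this predicate says that no denominator occurring in the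
  footprint of \<open>u\<close> vanishes.\<close>

definition footprint_well_defined ::
    "('m, 'p, 'd::finite) compressor \<Rightarrow> real \<Rightarrow> 'm \<Rightarrow> (real ^ 'd) \<Rightarrow> bool" where
  "footprint_well_defined K \<tau> m u \<longleftrightarrow>
     norm u \<noteq> 0 \<and> norm (reconstruct K \<tau> m u) \<noteq> 0 \<and> payload_size K (compress K \<tau> m u) \<noteq> 0"

definition mean_footprint ::
    "'w measure \<Rightarrow> real \<Rightarrow> ('m, 'p, 'd::finite) compressor \<Rightarrow> real \<Rightarrow> 'm
      \<Rightarrow> ('w \<Rightarrow> real ^ 'd) \<Rightarrow> real ^ 5" where
  "mean_footprint M \<kappa> K \<tau> m G = (\<integral>\<omega>. footprint \<kappa> K \<tau> m (G \<omega>) \<partial>M)"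

definition footprint_region :: "(real ^ 5) \<Rightarrow> real \<Rightarrow> (real ^ 5) set" where
  "footprint_region \<mu> R = {x. norm (x - \<mu>) \<le> R}"

end

theory Submission
  imports Defs
begin

text \<open>Disjointness is the triangle inequality: a point common to both balls would put their
  centres, the two mean footprints, within \<open>R\<^sub>H t + R\<^sub>A t\<close> of each other,
  against the gap \<open>\<Delta> t\<close>. The probability bound is a union bound: the two
  concentration events fail with probability at most \<open>\<gamma>\<^sub>H\<close> and
  \<open>\<gamma>\<^sub>A\<close>, so they hold together except on a set of probability at most the
  sum. This asks nothing about the joint law of the honest and malicious updates. The argument
  treats the footprints simply as measurable random vectors and does not look inside the five
  coordinates; \<open>prob_Int_ge\<close> carries the probabilistic half.\<close>

lemma footprint_region_eq_cball: "footprint_region \<mu> R = cball \<mu> R"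
  by (auto simp: footprint_region_def dist_norm norm_minus_commute)

text \<open>Bonferroni's inequality for two events, valid without independence: the part of
  \<open>A\<close> outside \<open>B\<close> lies in the complement of \<open>B\<close>, so
  intersecting with \<open>B\<close> costs \<open>A\<close> at most
  \<open>1 - prob B\<close>.\<close>

lemma (in prob_space) prob_Int_ge:
  assumes "A \<in> events" and "B \<in> events"
  shows "prob (A \<inter> B) \<ge> prob A + prob B - 1"
proof -
  have "prob A = prob (A \<inter> B) + prob (A - B)"
    using finite_measure_Diff'[OF assms] by simp
  moreover have "prob (A - B) \<le> prob (space M - B)"
    using assms sets.sets_into_space by (intro finite_measure_mono) auto
  ultimately show ?thesis
    using prob_compl[OF assms(2)] by simp
qed

theorem proposition1:
  fixes K :: "('m, 'p, 'd::finite) compressor" and \<tau> :: real and m :: 'm and \<kappa> :: real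
    and M :: "'w measure" and t :: nat
    and G\<^sub>H G\<^sub>A :: "nat \<Rightarrow> 'w \<Rightarrow> real ^ 'd"
    and P\<^sub>H P\<^sub>A :: "nat \<Rightarrow> (real ^ 'd) measure"
    and \<mu>\<^sub>H \<mu>\<^sub>A :: "nat \<Rightarrow> real ^ 5"
    and R\<^sub>H R\<^sub>A \<Delta> :: "nat \<Rightarrow> real"
    and \<gamma>\<^sub>H \<gamma>\<^sub>A :: real
    and B\<^sub>H B\<^sub>A :: "(real ^ 5) set"
  assumes "prob_space M"
    and "G\<^sub>H t \<in> borel_measurable M" and "G\<^sub>A t \<in> borel_measurable M"
    and "distr M borel (G\<^sub>H t) = P\<^sub>H t" and "distr M borel (G\<^sub>A t) = P\<^sub>A t"
    and "AE \<omega> in M. footprint_well_defined K \<tau> m (G\<^sub>H t \<omega>)"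
    and "AE \<omega> in M. footprint_well_defined K \<tau> m (G\<^sub>A t \<omega>)"
    and "integrable M (\<lambda>\<omega>. footprint \<kappa> K \<tau> m (G\<^sub>H t \<omega>))"
    and "integrable M (\<lambda>\<omega>. footprint \<kappa> K \<tau> m (G\<^sub>A t \<omega>))"
    and "\<mu>\<^sub>H t = mean_footprint M \<kappa> K \<tau> m (G\<^sub>H t)"
    and "\<mu>\<^sub>A t = mean_footprint M \<kappa> K \<tau> m (G\<^sub>A t)"
    and "\<Delta> t = norm (\<mu>\<^sub>A t - \<mu>\<^sub>H t)"
    and "0 \<le> \<gamma>\<^sub>H" and "\<gamma>\<^sub>H < 1" and "0 \<le> \<gamma>\<^sub>A" and "\<gamma>\<^sub>A < 1"
    and "measure M {\<omega> \<in> space M. norm (footprint \<kappa> K \<tau> m (G\<^sub>H t \<omega>) - \<mu>\<^sub>H t) \<le> R\<^sub>H t} \<ge> 1 - \<gamma>\<^sub>H"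
    and "measure M {\<omega> \<in> space M. norm (footprint \<kappa> K \<tau> m (G\<^sub>A t \<omega>) - \<mu>\<^sub>A t) \<le> R\<^sub>A t} \<ge> 1 - \<gamma>\<^sub>A"
    and "\<Delta> t > R\<^sub>H t + R\<^sub>A t"
    and "B\<^sub>H = footprint_region (\<mu>\<^sub>H t) (R\<^sub>H t)"
    and "B\<^sub>A = footprint_region (\<mu>\<^sub>A t) (R\<^sub>A t)"
  shows "B\<^sub>H \<inter> B\<^sub>A = {} \<and>
    measure M {\<omega> \<in> space M. footprint \<kappa> K \<tau> m (G\<^sub>H t \<omega>) \<in> B\<^sub>H \<and> footprint \<kappa> K \<tau> m (G\<^sub>A t \<omega>) \<in> B\<^sub>A}
      \<ge> 1 - \<gamma>\<^sub>H - \<gamma>\<^sub>A"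
proof
  interpret prob_space M by fact
  \<comment> \<open>Seen as closed balls, the regions are disjoint once the distance of the centres
    exceeds the sum of the radii. The radii may have either sign, since a ball of negative radius is
    empty.\<close>
  show "B\<^sub>H \<inter> B\<^sub>A = {}"
    using \<open>\<Delta> t > R\<^sub>H t + R\<^sub>A t\<close>
    unfolding \<open>\<Delta> t = _\<close> \<open>B\<^sub>H = _\<close> \<open>B\<^sub>A = _\<close> footprint_region_eq_cball
    by (intro disjoint_cballI) (simp add: dist_norm norm_minus_commute)
  \<comment> \<open>The compressor maps are arbitrary functions, so measurability of the footprints
    does not follow from that of the updates; it is extracted from integrability and makes the two
    concentration sets events.\<close>
  note [measurable] = borel_measurable_integrable[OF assms(8)] borel_measurable_integrable[OF assms(9)]
  let ?E\<^sub>H = "{\<omega> \<in> space M. norm (footprint \<kappa> K \<tau> m (G\<^sub>H t \<omega>) - \<mu>\<^sub>H t) \<le> R\<^sub>H t}"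
  let ?E\<^sub>A = "{\<omega> \<in> space M. norm (footprint \<kappa> K \<tau> m (G\<^sub>A t \<omega>) - \<mu>\<^sub>A t) \<le> R\<^sub>A t}"
  have "prob (?E\<^sub>H \<inter> ?E\<^sub>A) \<ge> prob ?E\<^sub>H + prob ?E\<^sub>A - 1"
    by (rule prob_Int_ge) measurable
  also have "?E\<^sub>H \<inter> ?E\<^sub>A =
      {\<omega> \<in> space M. footprint \<kappa> K \<tau> m (G\<^sub>H t \<omega>) \<in> B\<^sub>H \<and> footprint \<kappa> K \<tau> m (G\<^sub>A t \<omega>) \<in> B\<^sub>A}"
    unfolding \<open>B\<^sub>H = _\<close> \<open>B\<^sub>A = _\<close> footprint_region_def by auto
  finally show "prob {\<omega> \<in> space M. footprint \<kappa> K \<tau> m (G\<^sub>H t \<omega>) \<in> B\<^sub>H \<and> footprint \<kappa> K \<tau> m (G\<^sub>A t \<omega>) \<in> B\<^sub>A}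
      \<ge> 1 - \<gamma>\<^sub>H - \<gamma>\<^sub>A"
    \<comment> \<open>The arithmetic is \<open>(1 - \<gamma>\<^sub>H) + (1 - \<gamma>\<^sub>A) - 1 =
      1 - \<gamma>\<^sub>H - \<gamma>\<^sub>A\<close>.\<close>
    using assms(17,18) by linarith
qed

end
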